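(* Let $k\geq1$, $l\geq 0$ (so $k+l\geq1$), and let $S=sgp^+\langle a,b\mid a^kb^l=b^l\rangle$. Then $S$ is prefix-automatic if and only if $l\leq1$.
   Context: $sgp^+\langle A\mid R\rangle$ is the free semigroup $A^+$ of nonempty words modulo the congruence generated by $R$; $b^0$ is the empty word $\varepsilon$. Automaticity: regular = accepted by a finite automaton. With $\$\notin A$, $A(2,\$)=(A\cup\{\$\})^2\setminus\{(\$,\$)\}$; $(\alpha,\beta)\delta_A^R$ is the word over $A(2,\$)$ obtained by padding the shorter word on the right with $\$$'s and reading letter pairs. For a semigroup $S$ generated by finite $A$, $\phi:A^+\to S$ canonical, $L\subseteq A^+$ regular with $\phi(L)=S$, write $\alpha=\beta$ if $\phi(\alpha)=\phi(\beta)$ and $L_a^\$=\{(\alpha,\beta)\delta^R_A:\alpha,\beta\in L,\alpha a=\beta\}$ for $a\in A\cup\{\varepsilon\}$. $S$ is automatic if some such $(A,L)$ has all $L_a^\$$ regular; prefix-automatic if some such automatic structure also has $\{(\alpha,\beta)\delta_A^R:\alpha\in L,\beta\in\mathrm{Pref}(L),\alpha=\beta\}$ regular ($\mathrm{Pref}(L)$ = prefixes of words of $L$). A monoid is prefix-automatic if it is so as a semigroup. *)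

theory Defs
  imports Main
begin

definition regular :: "'c set \<Rightarrow> 'c list set \<Rightarrow> bool" where
  "regular \<Sigma> L \<longleftrightarrow> finite \<Sigma> \<and> L \<subseteq> lists \<Sigma> \<and>
     (\<exists>(Q::nat set) q0 (\<delta>::nat \<Rightarrow> 'c \<Rightarrow> nat) F.
        finite Q \<and> q0 \<in> Q \<and> (\<forall>q\<in>Q. \<forall>x\<in>\<Sigma>. \<delta> q x \<in> Q) \<and> F \<subseteq> Q \<and>
        L = {w \<in> lists \<Sigma>. foldl \<delta> q0 w \<in> F})"

definition pad :: "nat \<Rightarrow> 'a list \<Rightarrow> 'a option list" where
  "pad n w = map Some w @ replicate (n - length w) None"

definition conv :: "'a list \<Rightarrow> 'a list \<Rightarrow> ('a option \<times> 'a option) list" where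
  "conv u v = (let n = max (length u) (length v) in zip (pad n u) (pad n v))"

definition pad_alph :: "'a set \<Rightarrow> ('a option \<times> 'a option) set" where
  "pad_alph A = (insert None (Some ` A)) \<times> (insert None (Some ` A)) - {(None, None)}"

fun wprod :: "('s \<Rightarrow> 's \<Rightarrow> 's) \<Rightarrow> 's list \<Rightarrow> 's" where
  "wprod m [] = undefined"
| "wprod m (x # xs) = foldl m x xs"

definition Pref :: "'a list set \<Rightarrow> 'a list set" where
  "Pref L = {\<beta>. \<exists>\<gamma>. \<beta> @ \<gamma> \<in> L}"

definition Lsym :: "('s \<Rightarrow> 's \<Rightarrow> 's) \<Rightarrow> 's list set \<Rightarrow> 's option
                     \<Rightarrow> ('s option \<times> 's option) list set" where
  "Lsym m L a = {conv \<alpha> \<beta> | \<alpha> \<beta>. \<alpha> \<in> L \<and> \<beta> \<in> L \<and>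
       wprod m (\<alpha> @ (case a of None \<Rightarrow> [] | Some x \<Rightarrow> [x])) = wprod m \<beta>}"

definition automatic_structure :: "'s set \<Rightarrow> ('s \<Rightarrow> 's \<Rightarrow> 's) \<Rightarrow> 's set \<Rightarrow> 's list set \<Rightarrow> bool" where
  "automatic_structure S m A L \<longleftrightarrow>
     finite A \<and> A \<subseteq> S \<and> L \<subseteq> lists A - {[]} \<and> regular A L \<and> wprod m ` L = S \<and>
     (\<forall>a \<in> insert None (Some ` A). regular (pad_alph A) (Lsym m L a))"

definition automatic :: "'s set \<Rightarrow> ('s \<Rightarrow> 's \<Rightarrow> 's) \<Rightarrow> bool" where
  "automatic S m \<longleftrightarrow> (\<exists>A L. automatic_structure S m A L)"

definition prefix_automatic :: "'s set \<Rightarrow> ('s \<Rightarrow> 's \<Rightarrow> 's) \<Rightarrow> bool" where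
  "prefix_automatic S m \<longleftrightarrow> (\<exists>A L. automatic_structure S m A L \<and>
      regular (pad_alph A)
        {conv \<alpha> \<beta> | \<alpha> \<beta>. \<alpha> \<in> L \<and> \<beta> \<in> Pref L \<and> \<beta> \<noteq> [] \<and> wprod m \<alpha> = wprod m \<beta>})"

text \<open>Letters: True = a, False = b. The congruence generated by the relation
  on words (including the empty word, needed when l = 0).\<close>

inductive pcong :: "(bool list \<times> bool list) set \<Rightarrow> bool list \<Rightarrow> bool list \<Rightarrow> bool"
  for R where
  step: "(u, v) \<in> R \<Longrightarrow> pcong R (x @ u @ y) (x @ v @ y)"
| refl: "pcong R w w"
| sym: "pcong R u v \<Longrightarrow> pcong R v u"
| trans: "pcong R u v \<Longrightarrow> pcong R v w \<Longrightarrow> pcong R u w"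

definition rel_ab :: "nat \<Rightarrow> nat \<Rightarrow> (bool list \<times> bool list) set" where
  "rel_ab k l = {(replicate k True @ replicate l False, replicate l False)}"

definition cls :: "nat \<Rightarrow> nat \<Rightarrow> bool list \<Rightarrow> bool list set" where
  "cls k l w = {v. pcong (rel_ab k l) w v}"

definition S_ab :: "nat \<Rightarrow> nat \<Rightarrow> bool list set set" where
  "S_ab k l = {cls k l w | w. w \<noteq> []}"

definition mult_ab :: "nat \<Rightarrow> nat \<Rightarrow> bool list set \<Rightarrow> bool list set \<Rightarrow> bool list set" where
  "mult_ab k l X Y = cls k l ((SOME u. u \<in> X) @ (SOME v. v \<in> Y))"

end

theory Submission
  imports Defs
begin

text \<open>
  Let \<open>l \<ge> 2\<close>. Words without factor \<open>b\<^sup>l\<close> are alone in their class, so \<open>b\<close> belongs to every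
  generating set and \<open>comb k l n r\<close>, the word \<open>a\<^sup>k\<^sup>n (b a\<^sup>k)\<^sup>r b\<^sup>l\<^sup>-\<^sup>1\<close>, is spelled
  exactly by the letters of any of its representatives. Right multiplication by \<open>b\<close> turns it into \<open>b\<^sup>r\<^sup>+\<^sup>l\<close>, for every \<open>n\<close>. For \<open>n\<close> large, a representative of
  \<open>b\<^sup>r\<^sup>+\<^sup>l\<close> is exhausted before a representative of the comb reaches its first \<open>b\<close>; a finite automaton
  recognising right multiplication by \<open>b\<close> would have to remember \<open>r\<close> in its state at this point.
  Hence the semigroup is not even automatic.

  Let \<open>l \<le> 1\<close>. The nonempty words without factor \<open>a\<^sup>kb\<close> represent all elements and are closed under
  nonempty prefixes, so the prefix condition is the regularity of equality. Equality and right
  multiplication by a letter only relate words of the form \<open>w x\<close> and \<open>w y\<close>, where \<open>(x, y)\<close> ranges over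
  a finite union of products of two regular languages.
\<close>

section \<open>Languages with finitely many left quotients\<close>

definition quot :: "'c list \<Rightarrow> 'c list set \<Rightarrow> 'c list set" where
  "quot w L = {v. w @ v \<in> L}"

text \<open>The Myhill-Nerode criterion. It mentions neither states nor an alphabet, so a closure
  property only requires placing all quotients in a finite family of sets.\<close>

definition finite_quots :: "'c list set \<Rightarrow> bool" where
  "finite_quots L \<longleftrightarrow> finite (range (\<lambda>w. quot w L))"

lemma quot_Nil [simp]: "quot [] L = L"
  by (simp add: quot_def)

lemma quot_quot: "quot v (quot u L) = quot (u @ v) L"
  by (simp add: quot_def)

lemma finite_quots_subset:
  assumes "finite \<C>" "\<And>w. quot w L \<in> \<C>"
  shows "finite_quots L"
  unfolding finite_quots_def using assms by (meson finite_subset image_subsetI)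

text \<open>It suffices to find a finite-valued \<open>f\<close> that refines the Nerode
  equivalence: each quotient is then the quotient by a chosen word with the same value of
  \<open>f\<close>.\<close>

lemma finite_quots_classify:
  assumes "finite (range f)" "\<And>w w'. f w = f w' \<Longrightarrow> quot w L = quot w' L"
  shows "finite_quots L"
proof (rule finite_quots_subset)
  show "finite ((\<lambda>x. quot (SOME w. f w = x) L) ` range f)"
    using assms(1) by blast
  show "quot w L \<in> (\<lambda>x. quot (SOME w. f w = x) L) ` range f" for w
  proof -
    have "f (SOME w'. f w' = f w) = f w" by (rule someI) simp
    then have "quot w L = quot (SOME w'. f w' = f w) L" by (metis assms(2))
    then show ?thesis by blast
  qed
qed

text \<open>The states of the minimal automaton are the left quotients themselves, and a quotient is
  final if it contains the empty word.\<close>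

lemma regular_if_finite_quots:
  assumes "finite \<Sigma>" "L \<subseteq> lists \<Sigma>" "finite_quots L"
  shows "regular \<Sigma> L"
proof -
  define R where "R = range (\<lambda>w. quot w L)"
  have finR: "finite R" using assms(3) by (simp add: R_def finite_quots_def)
  obtain f :: "'a list set \<Rightarrow> nat" where f: "inj_on f R"
    using finite_imp_inj_to_nat_seg[OF finR] by blast
  \<comment> \<open>States must be natural numbers, so a state is decoded to its quotient, the
    quotient by \<open>x\<close> is taken, and the result is encoded again.\<close>
  define \<delta> where "\<delta> q x = f (quot [x] (inv_into R f q))" for q x
  have inR: "quot w L \<in> R" for w by (auto simp: R_def)
  have step: "\<delta> (f (quot w L)) x = f (quot (w @ [x]) L)" for w x
    by (simp add: \<delta>_def inv_into_f_f[OF f inR] quot_quot)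
  have run: "foldl \<delta> (f L) w = f (quot w L)" for w
    by (induction w rule: rev_induct) (simp_all add: step)
  define F where "F = f ` {K \<in> R. [] \<in> K}"
  have acc: "f (quot w L) \<in> F \<longleftrightarrow> w \<in> L" for w
  proof -
    have "f (quot w L) \<in> F \<longleftrightarrow> quot w L \<in> {K \<in> R. [] \<in> K}"
      unfolding F_def by (intro inj_on_image_mem_iff[OF f inR]) auto
    also have "\<dots> \<longleftrightarrow> w \<in> L" using inR by (simp add: quot_def)
    finally show ?thesis .
  qed
  have "finite (f ` R)" "f L \<in> f ` R" "F \<subseteq> f ` R"
    using finR inR[of "[]"] by (auto simp: F_def)
  moreover have "\<forall>q\<in>f ` R. \<forall>x\<in>\<Sigma>. \<delta> q x \<in> f ` R"
    using step inR by (auto simp: R_def)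
  moreover have "L = {w \<in> lists \<Sigma>. foldl \<delta> (f L) w \<in> F}"
    using assms(2) by (auto simp: run acc)
  ultimately show ?thesis
    unfolding regular_def using assms(1,2) by blast
qed

lemma finite_quots_Int:
  assumes "finite_quots K" "finite_quots L"
  shows "finite_quots (K \<inter> L)"
proof (rule finite_quots_subset)
  show "finite ((\<lambda>(X, Y). X \<inter> Y) ` (range (\<lambda>w. quot w K) \<times> range (\<lambda>w. quot w L)))"
    using assms by (simp add: finite_quots_def)
  show "quot w (K \<inter> L) \<in> (\<lambda>(X, Y). X \<inter> Y) ` (range (\<lambda>w. quot w K) \<times> range (\<lambda>w. quot w L))" for w
    by (rule image_eqI[of _ _ "(quot w K, quot w L)"]) (auto simp: quot_def)
qed

lemma finite_quots_Un:
  assumes "finite_quots K" "finite_quots L"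
  shows "finite_quots (K \<union> L)"
proof (rule finite_quots_subset)
  show "finite ((\<lambda>(X, Y). X \<union> Y) ` (range (\<lambda>w. quot w K) \<times> range (\<lambda>w. quot w L)))"
    using assms by (simp add: finite_quots_def)
  show "quot w (K \<union> L) \<in> (\<lambda>(X, Y). X \<union> Y) ` (range (\<lambda>w. quot w K) \<times> range (\<lambda>w. quot w L))" for w
    by (rule image_eqI[of _ _ "(quot w K, quot w L)"]) (auto simp: quot_def)
qed

lemma finite_quots_empty: "finite_quots {}"
  by (rule finite_quots_subset[of "{{}}"]) (auto simp: quot_def)

lemma finite_quots_UN:
  assumes "finite I" "\<And>i. i \<in> I \<Longrightarrow> finite_quots (L i)"
  shows "finite_quots (\<Union>i\<in>I. L i)"
  using assms by (induction I) (auto intro: finite_quots_Un finite_quots_empty)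

lemma finite_quots_dfa:
  assumes "finite (range (foldl \<delta> q))"
  shows "finite_quots {w. foldl \<delta> q w \<in> F}"
  by (rule finite_quots_classify[of "foldl \<delta> q"]) (use assms in \<open>auto simp: quot_def\<close>)

lemma finite_quots_vimage_morphism:
  assumes "finite_quots L" "\<And>u v. h (u @ v) = h u @ h v"
  shows "finite_quots {w. h w \<in> L}"
proof (rule finite_quots_subset)
  show "finite ((\<lambda>K. {w. h w \<in> K}) ` range (\<lambda>w. quot w L))"
    using assms(1) by (simp add: finite_quots_def)
  show "quot w {w. h w \<in> L} \<in> (\<lambda>K. {w. h w \<in> K}) ` range (\<lambda>w. quot w L)" for w
    by (rule image_eqI[of _ _ "quot (h w) L"]) (auto simp: quot_def assms(2))
qed

text \<open>By injectivity a prefix is the image of at most one word, so each quotient of the image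
  is empty or the image of a quotient.\<close>

lemma finite_quots_map_image:
  assumes "finite_quots L" "inj h"
  shows "finite_quots (map h ` L)"
proof (rule finite_quots_subset)
  show "finite (insert {} ((`) (map h) ` range (\<lambda>w. quot w L)))"
    using assms(1) by (simp add: finite_quots_def)
  show "quot w (map h ` L) \<in> insert {} ((`) (map h) ` range (\<lambda>w. quot w L))" for w
  proof (cases "\<exists>u. w = map h u")
    case True
    then obtain u where u: "w = map h u" by blast
    have "quot w (map h ` L) = map h ` quot u L"
    proof
      show "quot w (map h ` L) \<subseteq> map h ` quot u L"
      proof
        fix v assume "v \<in> quot w (map h ` L)"
        then obtain x where x: "x \<in> L" "map h u @ v = map h x"
          by (auto simp: quot_def u)
        then obtain x1 x2 where "x = x1 @ x2" "map h u = map h x1" "v = map h x2"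
          by (metis map_eq_append_conv)
        moreover from this have "u = x1" using assms(2) by (metis inj_map_eq_map)
        ultimately show "v \<in> map h ` quot u L" using x by (auto simp: quot_def)
      qed
    qed (force simp: quot_def u simp flip: map_append)
    then show ?thesis by blast
  next
    case False
    then have "quot w (map h ` L) = {}"
      by (auto simp: quot_def) (metis map_eq_append_conv)
    then show ?thesis by simp
  qed
qed

lemma finite_quots_Cons_image:
  assumes "finite_quots L"
  shows "finite_quots ((#) x ` L)"
proof (rule finite_quots_subset)
  show "finite ({{}, (#) x ` L} \<union> range (\<lambda>w. quot w L))"
    using assms by (simp add: finite_quots_def)
  show "quot w ((#) x ` L) \<in> {{}, (#) x ` L} \<union> range (\<lambda>w. quot w L)" for w
  proof (cases w)
    case (Cons y w')
    have "quot w ((#) x ` L) = (if x = y then quot w' L else {})"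
      by (auto simp: quot_def Cons)
    then show ?thesis by auto
  qed simp
qed

text \<open>A subset construction: a word already read either still lies within the factor over
  \<open>D\<close>, or has passed into \<open>L\<close> at one of several possible positions. The
  latter contribute a union of quotients of \<open>L\<close>, of which there are finitely
  many.\<close>

lemma finite_quots_lists_append:
  assumes "finite_quots L"
  shows "finite_quots {u @ v | u v. u \<in> lists D \<and> v \<in> L}" (is "finite_quots ?K")
proof (rule finite_quots_subset)
  let ?\<C> = "(\<lambda>(X, Y). X \<union> \<Union>Y) ` ({{}, ?K} \<times> Pow (range (\<lambda>w. quot w L)))"
  show "finite ?\<C>" using assms by (simp add: finite_quots_def)
  show "quot w ?K \<in> ?\<C>" for w
  proof (rule image_eqI)
    let ?X = "if w \<in> lists D then ?K else {}"
    let ?Y = "{quot v L | u v. w = u @ v \<and> u \<in> lists D}"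
    show "quot w ?K = (\<lambda>(X, Y). X \<union> \<Union>Y) (?X, ?Y)"
    proof (simp only: prod.case, intro equalityI subsetI)
      fix z assume "z \<in> quot w ?K"
      then obtain u v where uv: "w @ z = u @ v" "u \<in> lists D" "v \<in> L"
        by (auto simp: quot_def)
      from uv(1) consider x where "w = u @ x" "x @ z = v" | x where "w @ x = u" "z = x @ v"
        by (auto simp: append_eq_append_conv2)
      then show "z \<in> ?X \<union> \<Union>?Y"
      proof cases
        case (1 x)
        then have "z \<in> quot x L" using uv by (simp add: quot_def)
        then show ?thesis using 1 uv by blast
      next
        case (2 x)
        then have "w \<in> lists D" "x \<in> lists D" using uv by auto
        then show ?thesis using 2 uv by auto
      qed
    next
      fix z assume "z \<in> ?X \<union> \<Union>?Y"
      then consider u v where "w \<in> lists D" "z = u @ v" "u \<in> lists D" "v \<in> L"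
        | u v where "w = u @ v" "u \<in> lists D" "v @ z \<in> L"
        by (auto simp: quot_def split: if_splits)
      then show "z \<in> quot w ?K"
      proof cases
        case (1 u v)
        then have "w @ z = (w @ u) @ v" "w @ u \<in> lists D" by auto
        then show ?thesis using 1 unfolding quot_def by blast
      next
        case (2 u v)
        then have "w @ z = u @ (v @ z)" by auto
        then show ?thesis using 2 unfolding quot_def by blast
      qed
    qed
    show "(?X, ?Y) \<in> {{}, ?K} \<times> Pow (range (\<lambda>w. quot w L))" by auto
  qed
qed

section \<open>Convolutions\<close>

lemma conv_simps [simp]:
  "conv [] [] = []"
  "conv (x # xs) [] = (Some x, None) # conv xs []"
  "conv [] (y # ys) = (None, Some y) # conv [] ys"
  "conv (x # xs) (y # ys) = (Some x, Some y) # conv xs ys"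
  by (simp_all add: conv_def pad_def Let_def)

lemma conv_append_same: "conv (w @ x) (w @ y) = map (\<lambda>c. (Some c, Some c)) w @ conv x y"
  by (induction w) auto

lemma conv_append_left:
  "length u = length v \<Longrightarrow> conv (u @ x) v = conv u v @ conv x []"
  by (induction u v rule: list_induct2) auto

lemma conv_induct [case_names Nil_Nil Cons_Nil Nil_Cons Cons_Cons]:
  assumes "P [] []"
    and "\<And>x xs. P xs [] \<Longrightarrow> P (x # xs) []"
    and "\<And>y ys. P [] ys \<Longrightarrow> P [] (y # ys)"
    and "\<And>x xs y ys. P xs ys \<Longrightarrow> P (x # xs) (y # ys)"
  shows "P u v"
proof (induction u arbitrary: v)
  case Nil
  show ?case using assms by (induction v) auto
next
  case (Cons x u)
  then show ?case using assms by (cases v) auto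
qed

lemma conv_map:
  "conv (map h u) (map h v) = map (map_prod (map_option h) (map_option h)) (conv u v)"
  by (induction u v rule: conv_induct) auto

lemma conv_in_lists_pad_alph:
  "u \<in> lists A \<Longrightarrow> v \<in> lists A \<Longrightarrow> conv u v \<in> lists (pad_alph A)"
  by (induction u v rule: conv_induct) (auto simp: pad_alph_def)

text \<open>One component of a word of pairs, with the padding erased. As a morphism it has
  preimages with finitely many quotients, and on convolutions it recovers the original
  words.\<close>

definition track :: "('p \<Rightarrow> 'a option) \<Rightarrow> 'p list \<Rightarrow> 'a list" where
  "track f \<gamma> = concat (map (\<lambda>p. case f p of None \<Rightarrow> [] | Some x \<Rightarrow> [x]) \<gamma>)"

lemma track_append: "track f (u @ v) = track f u @ track f v"
  by (simp add: track_def)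

lemma track_fst_conv [simp]: "track fst (conv u v) = u"
  by (induction u v rule: conv_induct) (auto simp: track_def)

lemma track_snd_conv [simp]: "track snd (conv u v) = v"
  by (induction u v rule: conv_induct) (auto simp: track_def)

lemma conv_inject: "conv u v = conv u' v' \<longleftrightarrow> u = u' \<and> v = v'"
  by (metis track_fst_conv track_snd_conv)

text \<open>Padding that has begun on a track never stops. Stating this pairwise by
  \<open>sorted_wrt\<close> makes it split over concatenation, as the computation of quotients
  requires.\<close>

lemma range_conv_iff:
  "(\<exists>u v. \<gamma> = conv u v) \<longleftrightarrow> (None, None) \<notin> set \<gamma> \<and>
    sorted_wrt (\<lambda>p q. (fst p = None \<longrightarrow> fst q = None) \<and> (snd p = None \<longrightarrow> snd q = None)) \<gamma>"
  (is "_ \<longleftrightarrow> _ \<and> sorted_wrt ?R \<gamma>")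
proof
  have fst_None: "fst p = None" if "p \<in> set (conv [] v)" for v :: "'b list" and p :: "'b option \<times> _"
    using that by (induction v) auto
  have snd_None: "snd p = None" if "p \<in> set (conv u [])" for u :: "'b list" and p :: "_ \<times> 'b option"
    using that by (induction u) auto
  assume "\<exists>u v. \<gamma> = conv u v"
  then obtain u v where "\<gamma> = conv u v" by blast
  moreover have "(None, None) \<notin> set (conv u v) \<and> sorted_wrt ?R (conv u v)"
    by (induction u v rule: conv_induct) (auto dest: fst_None snd_None)
  ultimately show "(None, None) \<notin> set \<gamma> \<and> sorted_wrt ?R \<gamma>" by simp
next
  assume "(None, None) \<notin> set \<gamma> \<and> sorted_wrt ?R \<gamma>"
  then show "\<exists>u v. \<gamma> = conv u v"
  proof (induction \<gamma>)
    case (Cons p \<gamma>)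
    then obtain u v where uv: "\<gamma> = conv u v" by auto
    have u: "u = []" if "fst p = None"
    proof (rule ccontr)
      assume "u \<noteq> []"
      then obtain x u' where "u = x # u'" by (cases u) auto
      then have "\<exists>q \<in> set \<gamma>. fst q \<noteq> None" by (cases v) (auto simp: uv)
      then show False using Cons.prems that by auto
    qed
    have v: "v = []" if "snd p = None"
    proof (rule ccontr)
      assume "v \<noteq> []"
      then obtain y v' where "v = y # v'" by (cases v) auto
      then have "\<exists>q \<in> set \<gamma>. snd q \<noteq> None" by (cases u) (auto simp: uv)
      then show False using Cons.prems that by auto
    qed
    show ?case
    proof (cases p)
      case (Pair x y)
      show ?thesis
      proof (cases x)
        case None
        then obtain y' where "y = Some y'" using Cons.prems Pair by (cases y) auto
        then have "p # \<gamma> = conv [] (y' # v)" using None Pair u uv by simp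
        then show ?thesis by blast
      next
        case (Some x')
        show ?thesis
        proof (cases y)
          case None
          then have "p # \<gamma> = conv (x' # u) []" using Some Pair v uv by simp
          then show ?thesis by blast
        next
          case (Some y')
          then have "p # \<gamma> = conv (x' # u) (y' # v)" using \<open>x = Some x'\<close> Pair uv by simp
          then show ?thesis by blast
        qed
      qed
    qed
  qed (metis conv_simps(1))
qed

text \<open>Three flags determine the admissible continuations: whether the word read is a
  convolution, and for each track whether its padding has begun.\<close>

lemma finite_quots_range_conv:
  "finite_quots {\<gamma> :: ('a option \<times> 'a option) list. \<exists>u v. \<gamma> = conv u v}"
proof (rule finite_quots_classify)
  let ?f = "\<lambda>\<gamma>. (\<exists>u v. \<gamma> = conv u v, \<exists>p\<in>set \<gamma>. fst p = None, \<exists>p\<in>set \<gamma>. snd p = None)"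
  show "finite (range ?f)" by (rule finite_subset[OF subset_UNIV]) simp
  show "quot \<gamma> {\<gamma>. \<exists>u v. \<gamma> = conv u v} = quot \<gamma>' {\<gamma>. \<exists>u v. \<gamma> = conv u v}"
    if "?f \<gamma> = ?f \<gamma>'" for \<gamma> \<gamma>' :: "('a option \<times> 'a option) list"
  proof -
    have split: "(\<exists>u v. \<gamma> @ z = conv u v) \<longleftrightarrow> (\<exists>u v. \<gamma> = conv u v) \<and> (\<exists>u v. z = conv u v) \<and>
       ((\<exists>p\<in>set \<gamma>. fst p = None) \<longrightarrow> (\<forall>q\<in>set z. fst q = None)) \<and>
       ((\<exists>p\<in>set \<gamma>. snd p = None) \<longrightarrow> (\<forall>q\<in>set z. snd q = None))"
      for \<gamma> z :: "('a option \<times> 'a option) list"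
      unfolding range_conv_iff sorted_wrt_append by auto
    from that show ?thesis unfolding quot_def mem_Collect_eq split by simp
  qed
qed

text \<open>Among correctly padded words, membership can be tested on each track separately.\<close>

lemma finite_quots_conv_product:
  assumes "finite_quots K" "finite_quots L"
  shows "finite_quots {conv u v | u v. u \<in> K \<and> v \<in> L}"
proof -
  have "{conv u v | u v. u \<in> K \<and> v \<in> L} =
    {\<gamma>. \<exists>u v. \<gamma> = conv u v} \<inter> ({\<gamma>. track fst \<gamma> \<in> K} \<inter> {\<gamma>. track snd \<gamma> \<in> L})"
    by (auto simp: conv_inject)
  then show ?thesis
    by (simp add: finite_quots_Int finite_quots_range_conv finite_quots_vimage_morphism
        track_append assms)
qed

text \<open>A common prefix appears in the convolution as a word over the diagonal letters, followed
  by the convolution of the remainders.\<close>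

lemma finite_quots_conv_common_prefix:
  assumes "finite_quots {conv u v | u v. P u v}"
  shows "finite_quots {conv (w @ u) (w @ v) | w u v. P u v}"
proof -
  let ?d = "\<lambda>c. (Some c, Some c)"
  have "{conv (w @ u) (w @ v) | w u v. P u v} =
      {x @ y | x y. x \<in> lists (range ?d) \<and> y \<in> {conv u v | u v. P u v}}"
    unfolding lists_image lists_UNIV by (auto simp: conv_append_same)
  then show ?thesis using finite_quots_lists_append[OF assms] by simp
qed

section \<open>The semigroup of the presentation\<close>

lemma pcong_append: "pcong R u v \<Longrightarrow> pcong R (x @ u @ y) (x @ v @ y)"
proof (induction rule: pcong.induct)
  case (step u v x' y')
  then have "pcong R ((x @ x') @ u @ (y' @ y)) ((x @ x') @ v @ (y' @ y))" by (rule pcong.step)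
  then show ?case by simp
qed (auto intro: pcong.intros)

lemma cls_eq_iff: "cls k l u = cls k l v \<longleftrightarrow> pcong (rel_ab k l) u v"
  unfolding cls_def by (auto intro: pcong.intros)

lemma cls_some: "pcong (rel_ab k l) u (SOME v. v \<in> cls k l u)"
proof -
  have "(SOME v. v \<in> cls k l u) \<in> cls k l u"
    by (rule someI[of _ u]) (simp add: cls_def pcong.refl)
  then show ?thesis by (simp add: cls_def)
qed

text \<open>The product is defined through chosen representatives; compatibility of the congruence
  with both sides makes the choice irrelevant.\<close>

lemma mult_cls: "mult_ab k l (cls k l u) (cls k l v) = cls k l (u @ v)"
proof -
  have "pcong (rel_ab k l) (u @ v) ((SOME x. x \<in> cls k l u) @ v)"
    using pcong_append[OF cls_some, of k l "[]" u v] by simp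
  moreover have "pcong (rel_ab k l) ((SOME x. x \<in> cls k l u) @ v)
      ((SOME x. x \<in> cls k l u) @ (SOME x. x \<in> cls k l v))"
    using pcong_append[OF cls_some, of k l _ v "[]"] by simp
  ultimately have "pcong (rel_ab k l) (u @ v)
      ((SOME x. x \<in> cls k l u) @ (SOME x. x \<in> cls k l v))"
    by (rule pcong.trans)
  then show ?thesis unfolding mult_ab_def by (metis cls_eq_iff)
qed

lemma wprod_cls:
  assumes "us \<noteq> []"
  shows "wprod (mult_ab k l) (map (cls k l) us) = cls k l (concat us)"
proof -
  have fold: "foldl (mult_ab k l) (cls k l u) (map (cls k l) vs) = cls k l (u @ concat vs)" for u vs
    by (induction vs arbitrary: u) (simp_all add: mult_cls)
  from assms show ?thesis by (cases us) (simp_all add: fold)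
qed

lemma pcong_absorb_power:
  "pcong (rel_ab k l) (x @ replicate (k * n) True @ replicate l False @ y) (x @ replicate l False @ y)"
proof (induction n)
  case 0
  show ?case by (simp add: pcong.refl)
next
  case (Suc n)
  have "pcong (rel_ab k l)
      ((x @ replicate (k * n) True) @ (replicate k True @ replicate l False) @ y)
      ((x @ replicate (k * n) True) @ replicate l False @ y)"
    by (rule pcong.step) (simp add: rel_ab_def)
  moreover have "x @ replicate (k * Suc n) True @ replicate l False @ y =
      (x @ replicate (k * n) True) @ (replicate k True @ replicate l False) @ y"
    by (simp add: replicate_add flip: append_assoc) (simp add: add.commute flip: replicate_add)
  ultimately have "pcong (rel_ab k l) (x @ replicate (k * Suc n) True @ replicate l False @ y)
      (x @ replicate (k * n) True @ replicate l False @ y)" by simp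
  then show ?case using Suc pcong.trans by blast
qed

section \<open>The case of exponent at least two\<close>

lemma count_b_replicate [simp]:
  "count_list (replicate n True) False = 0" "count_list (replicate n False) False = n"
  by (induction n) auto

lemma pcong_count_b:
  "pcong (rel_ab k l) u v \<Longrightarrow> count_list u False = count_list v False"
proof (induction rule: pcong.induct)
  case (step u v x y)
  then show ?case by (auto simp: rel_ab_def)
qed auto

text \<open>Tests that no run of b reaches length \<open>l\<close>; the counter \<open>c\<close> is
  the length of the run that ends the text already read.\<close>

fun short_b_runs :: "nat \<Rightarrow> nat \<Rightarrow> bool list \<Rightarrow> bool" where
  "short_b_runs l c [] \<longleftrightarrow> True"
| "short_b_runs l c (True # w) \<longleftrightarrow> short_b_runs l 0 w"
| "short_b_runs l c (False # w) \<longleftrightarrow> Suc c < l \<and> short_b_runs l (Suc c) w"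

lemma short_b_runs_appendD: "short_b_runs l c (u @ v) \<Longrightarrow> \<exists>c'. short_b_runs l c' v"
  by (induction l c u rule: short_b_runs.induct) auto

lemma short_b_runs_replicate_b:
  "short_b_runs l c (replicate n False @ y) \<Longrightarrow> n = 0 \<or> c + n < l"
proof (induction n arbitrary: c)
  case (Suc n)
  then show ?case using Suc.IH[of "Suc c"] by auto
qed simp

lemma short_b_runs_no_factor:
  assumes "l \<ge> 1"
  shows "\<not> short_b_runs l c (x @ replicate l False @ y)"
proof
  assume "short_b_runs l c (x @ replicate l False @ y)"
  then obtain c' where "short_b_runs l c' (replicate l False @ y)"
    using short_b_runs_appendD by blast
  then show False using assms short_b_runs_replicate_b by fastforce
qed

text \<open>Both sides of a rewriting step contain \<open>b^l\<close>, so a word without this factor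
  admits no step at all.\<close>

lemma pcong_short_b_runs:
  assumes "l \<ge> 1" "short_b_runs l 0 u" "pcong (rel_ab k l) u v"
  shows "u = v"
proof -
  have "u = v \<or> (\<exists>x y. u = x @ replicate l False @ y) \<and> (\<exists>x y. v = x @ replicate l False @ y)"
    using assms(3)
  proof (induction rule: pcong.induct)
    case (step u v x y)
    then have "x @ u @ y = (x @ replicate k True) @ replicate l False @ y"
      "x @ v @ y = x @ replicate l False @ y" by (auto simp: rel_ab_def)
    then show ?case by blast
  qed auto
  then show ?thesis using assms short_b_runs_no_factor by blast
qed

section \<open>Comb words and their products with b\<close>

definition comb :: "nat \<Rightarrow> nat \<Rightarrow> nat \<Rightarrow> nat \<Rightarrow> bool list" where
  "comb k l n r = replicate (k * n) True @ concat (replicate r (False # replicate k True))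
     @ replicate (l - 1) False"

text \<open>Since \<open>k >= 1\<close>, the blocks of a separate the b's; since
  \<open>l >= 2\<close>, a single b is shorter than \<open>b^l\<close>, as is the final run of
  \<open>l - 1\<close> letters.\<close>

lemma short_b_runs_comb:
  assumes "k \<ge> 1" "l \<ge> 2"
  shows "short_b_runs l 0 (comb k l n r)"
proof -
  have a: "short_b_runs l 0 (replicate m True @ w) \<longleftrightarrow> short_b_runs l 0 w" for m w
    by (induction m) auto
  have a1: "short_b_runs l c (replicate k True @ w) \<longleftrightarrow> short_b_runs l 0 w" for c w
    using assms(1) a by (cases k) auto
  have b: "c + m < l \<Longrightarrow> short_b_runs l c (replicate m False)" for c m
    by (induction m arbitrary: c) auto
  have "short_b_runs l 0 (concat (replicate r (False # replicate k True)) @ replicate (l - 1) False)"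
    using assms(2) by (induction r) (auto simp: a1 intro: b)
  then show ?thesis by (simp add: comb_def a)
qed

lemma count_b_comb: "l \<ge> 1 \<Longrightarrow> Suc (count_list (comb k l n r) False) = r + l"
proof -
  have "count_list (concat (replicate r (False # replicate k True))) False = r"
    by (induction r) auto
  then show "l \<ge> 1 \<Longrightarrow> ?thesis" by (simp add: comb_def)
qed

text \<open>The new b completes \<open>b^l\<close>, which absorbs the \<open>a^k\<close> on its left
  and meets another b. The teeth thus vanish from right to left, and finally the initial power of a
  is absorbed.\<close>

lemma pcong_comb_b:
  assumes "l \<ge> 1"
  shows "pcong (rel_ab k l) (comb k l n r @ [False]) (replicate (r + l) False)"
proof -
  let ?teeth = "\<lambda>r. concat (replicate r (False # replicate k True))"
  have teeth: "pcong (rel_ab k l) (?teeth r @ replicate l False) (replicate (r + l) False)"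
  proof (induction r)
    case 0
    show ?case by (simp add: pcong.refl)
  next
    case (Suc r)
    have "pcong (rel_ab k l) (?teeth (Suc r) @ replicate l False)
        ((False # replicate k True) @ replicate (r + l) False)"
      using pcong_append[OF Suc, of "False # replicate k True" "[]"] by simp
    moreover have "pcong (rel_ab k l) ((False # replicate k True) @ replicate (r + l) False)
        ([False] @ replicate l False @ replicate r False)"
      using pcong_absorb_power[of k l "[False]" 1 "replicate r False"]
      by (simp add: add.commute[of r] replicate_add)
    ultimately have "pcong (rel_ab k l) (?teeth (Suc r) @ replicate l False)
        ([False] @ replicate l False @ replicate r False)" by (rule pcong.trans)
    then show ?case by (simp add: add.commute[of r] replicate_add)
  qed
  have "replicate (l - 1) False @ [False] = replicate l False"
    using assms by (metis Suc_pred' less_eq_Suc_le One_nat_def replicate_Suc replicate_append_same)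
  then have "pcong (rel_ab k l) (comb k l n r @ [False])
      (replicate (k * n) True @ replicate (r + l) False)"
    using pcong_append[OF teeth, of "replicate (k * n) True" "[]"] by (simp add: comb_def)
  moreover have "pcong (rel_ab k l) (replicate (k * n) True @ replicate (r + l) False)
      (replicate (r + l) False)"
    using pcong_absorb_power[of k l "[]" n "replicate r False"]
    by (simp add: add.commute[of r] replicate_add)
  ultimately show ?thesis by (rule pcong.trans)
qed

section \<open>Exchange argument against automaticity\<close>

lemma length_concat_map_le:
  assumes "\<And>x. x \<in> A \<Longrightarrow> length (f x) \<le> M" "\<alpha> \<in> lists A"
  shows "length (concat (map f \<alpha>)) \<le> M * length \<alpha>"
  using assms(2) by (induction \<alpha>) (use assms(1) in \<open>fastforce\<close>)+

lemma not_automatic: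
  assumes "k \<ge> 1" "l \<ge> 2"
  shows "\<not> automatic (S_ab k l) (mult_ab k l)"
proof
  assume "automatic (S_ab k l) (mult_ab k l)"
  then obtain A L where AL: "automatic_structure (S_ab k l) (mult_ab k l) A L"
    by (auto simp: automatic_def)
  let ?m = "mult_ab k l"
  have finA: "finite A" and AS: "A \<subseteq> S_ab k l" and LA: "L \<subseteq> lists A - {[]}"
    and onto: "wprod ?m ` L = S_ab k l"
    and reg: "\<And>x. x \<in> A \<Longrightarrow> regular (pad_alph A) (Lsym ?m L (Some x))"
    using AL by (auto simp: automatic_structure_def)
  \<comment> \<open>The generators are arbitrary elements of the semigroup, so words over
    \<open>A\<close> are compared through their spellings over the letters a and b.\<close>
  define rep :: "bool list set \<Rightarrow> bool list" where "rep x = (SOME u. u \<in> x)" for x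
  define sp where "sp \<alpha> = concat (map rep \<alpha>)" for \<alpha>
  have sp_append: "sp (\<alpha> @ \<beta>) = sp \<alpha> @ sp \<beta>" for \<alpha> \<beta> by (simp add: sp_def)
  have rep: "cls k l (rep x) = x" if "x \<in> A" for x
  proof -
    obtain u where "x = cls k l u" using \<open>x \<in> A\<close> AS by (auto simp: S_ab_def)
    then show ?thesis using cls_some[of k l u] by (metis cls_eq_iff rep_def)
  qed
  have wprod_sp: "wprod ?m \<alpha> = cls k l (sp \<alpha>)" if "\<alpha> \<in> lists A" "\<alpha> \<noteq> []" for \<alpha>
  proof -
    have "map (cls k l) (map rep \<alpha>) = \<alpha>" using that(1) rep by (induction \<alpha>) auto
    then show ?thesis using wprod_cls[of "map rep \<alpha>" k l] that(2) by (simp add: sp_def)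
  qed
  have represent: "\<exists>\<alpha>\<in>L. pcong (rel_ab k l) u (sp \<alpha>)" if "u \<noteq> []" for u
  proof -
    have "cls k l u \<in> wprod ?m ` L" using that by (auto simp: onto S_ab_def)
    then obtain \<alpha> where \<alpha>: "\<alpha> \<in> L" "cls k l u = wprod ?m \<alpha>" by blast
    moreover have "\<alpha> \<in> lists A" "\<alpha> \<noteq> []" using \<alpha>(1) LA by auto
    ultimately have "cls k l u = cls k l (sp \<alpha>)" using wprod_sp by metis
    then show ?thesis using \<alpha>(1) by (auto simp: cls_eq_iff)
  qed
  define b where "b = cls k l [False]"
  have bA: "b \<in> A"
  proof -
    \<comment> \<open>The word b is alone in its class, so a product of generators equal to it
      spells exactly one letter, and some generator in it spells b.\<close>
    obtain \<alpha> where \<alpha>: "\<alpha> \<in> L" "pcong (rel_ab k l) [False] (sp \<alpha>)" using represent by blast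
    have "sp \<alpha> = [False]" using pcong_short_b_runs[OF _ _ \<alpha>(2)] assms by simp
    then have "[False] \<in> set (map rep \<alpha>)" unfolding sp_def
      by (induction \<alpha>) (auto simp: append_eq_Cons_conv)
    then obtain x where "x \<in> set \<alpha>" "rep x = [False]" by auto
    then show ?thesis using rep[of x] \<alpha>(1) LA by (auto simp: b_def)
  qed
  define M where "M = (\<Sum>x\<in>A. length (rep x))"
  have sp_length: "length (sp \<alpha>) \<le> M * length \<alpha>" if "\<alpha> \<in> lists A" for \<alpha>
    unfolding sp_def using that finA
    by (intro length_concat_map_le) (auto simp: M_def intro!: member_le_sum)
  have "\<exists>\<beta>\<in>L. pcong (rel_ab k l) (replicate (r + l) False) (sp \<beta>)" for r
    using assms by (intro represent) auto
  then obtain B where B: "\<And>r. B r \<in> L"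
    "\<And>r. pcong (rel_ab k l) (replicate (r + l) False) (sp (B r))" by metis
  \<comment> \<open>With this exponent the initial power of a is longer than anything that
    \<open>length (B r)\<close> generators can spell.\<close>
  define w where "w r = comb k l (Suc (M * length (B r))) r" for r
  have "\<exists>\<alpha>\<in>L. pcong (rel_ab k l) (w r) (sp \<alpha>)" for r
    using assms by (intro represent) (auto simp: w_def comb_def)
  then obtain C where C: "\<And>r. C r \<in> L" "\<And>r. pcong (rel_ab k l) (w r) (sp (C r))" by metis
  have spC: "sp (C r) = w r" for r
    using pcong_short_b_runs[OF _ _ C(2)] short_b_runs_comb assms by (simp add: w_def)
  \<comment> \<open>\<open>C1 r\<close> is read in parallel with \<open>B r\<close>, and
    \<open>C2 r\<close> against padding.\<close>
  define C1 where "C1 r = take (length (B r)) (C r)" for r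
  define C2 where "C2 r = drop (length (B r)) (C r)" for r
  have C12: "C r = C1 r @ C2 r" for r by (simp add: C1_def C2_def)
  have listsC: "C1 r \<in> lists A" "C2 r \<in> lists A" for r
    using C(1)[of r] LA C12[of r] by auto
  have count1: "count_list (sp (C1 r)) False = 0" for r
  proof -
    let ?n = "length (sp (C1 r))"
    have "?n \<le> M * length (C1 r)" using sp_length listsC by blast
    also have "\<dots> \<le> M * length (B r)" by (simp add: C1_def)
    also have "\<dots> \<le> k * Suc (M * length (B r))"
      using assms(1) by (metis le_SucI le_trans mult_1 mult_le_mono1 order_refl)
    finally have n: "?n \<le> k * Suc (M * length (B r))" .
    have "sp (C1 r) = take ?n (w r)" using spC[of r] C12[of r] by (metis append_eq_conv_conj sp_append)
    also have "\<dots> = replicate ?n True" using n by (simp add: w_def comb_def min_def del: mult_Suc_right)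
    finally show ?thesis by (metis count_b_replicate(1))
  qed
  have count2: "Suc (count_list (sp (C2 r)) False) = r + l" for r
  proof -
    have "Suc (count_list (sp (C r)) False) = r + l"
      using count_b_comb assms(2) by (simp add: spC w_def)
    then show ?thesis using count1[of r] by (simp add: C12[of r] sp_append)
  qed
  \<comment> \<open>If \<open>C r\<close> ended before \<open>B r\<close>, then \<open>C2 r\<close>
    would be empty; yet it carries all \<open>r + l - 1 >= 1\<close> letters b.\<close>
  have len1: "length (C1 r) = length (B r)" for r
  proof (rule ccontr)
    assume "length (C1 r) \<noteq> length (B r)"
    then have "C2 r = []" by (auto simp: C1_def C2_def)
    then show False using count2[of r] assms(2) by (simp add: sp_def)
  qed
  have conv_split: "conv (C1 r @ C2 s) (B r) = conv (C1 r) (B r) @ conv (C2 s) []" for r s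
    using len1 by (rule conv_append_left)
  obtain Q q0 \<delta> F where finQ: "finite (Q :: nat set)" and q0: "q0 \<in> Q"
    and \<delta>: "\<forall>q\<in>Q. \<forall>x\<in>pad_alph A. \<delta> q x \<in> Q"
    and acc: "Lsym ?m L (Some b) = {w \<in> lists (pad_alph A). foldl \<delta> q0 w \<in> F}"
    using reg[OF bA] unfolding regular_def by blast
  have in_Lsym: "conv (C r) (B r) \<in> Lsym ?m L (Some b)" for r
  proof -
    have "pcong (rel_ab k l) (w r @ [False]) (replicate (r + l) False)"
      using pcong_comb_b assms(2) by (simp add: w_def)
    then have "pcong (rel_ab k l) (w r @ [False]) (sp (B r))" using B(2) pcong.trans by blast
    moreover have "pcong (rel_ab k l) (w r @ rep b) (w r @ [False])"
      using pcong_append[of "rel_ab k l" "rep b" "[False]" "w r" "[]"] rep[OF bA]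
      by (simp add: b_def cls_eq_iff)
    ultimately have "cls k l (sp (C r @ [b])) = cls k l (sp (B r))"
      by (simp add: cls_eq_iff sp_append spC) (metis append_Nil2 concat.simps list.simps(8,9) pcong.trans sp_def)
    moreover have "C r @ [b] \<in> lists A" "B r \<in> lists A" "B r \<noteq> []"
      using C(1) B(1) LA bA by auto
    ultimately have "wprod ?m (C r @ [b]) = wprod ?m (B r)" by (simp add: wprod_sp)
    then show ?thesis using C(1) B(1) unfolding Lsym_def by force
  qed
  \<comment> \<open>The state in which \<open>B r\<close> has just been exhausted. Finitely many
    states force a collision between some \<open>r\<close> and \<open>s\<close>.\<close>
  define q where "q r = foldl \<delta> q0 (conv (C1 r) (B r))" for r
  have run_Q: "foldl \<delta> q0 u \<in> Q" if "u \<in> lists (pad_alph A)" for u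
    using that q0 \<delta> by (induction u rule: rev_induct) auto
  have listsB: "B r \<in> lists A" for r using B(1) LA by auto
  have "q r \<in> Q" for r
    unfolding q_def by (intro run_Q conv_in_lists_pad_alph listsC listsB)
  then have "finite (range q)" using finQ by (meson finite_subset image_subsetI)
  then have "\<not> inj q" using finite_imageD infinite_UNIV_nat by blast
  then obtain r s where rs: "r \<noteq> s" "q r = q s" by (auto simp: inj_def)
  \<comment> \<open>After the collision the automaton cannot tell the tails apart, so the tail for
    \<open>r\<close> is accepted after the beginning for \<open>s\<close>.\<close>
  have "conv (C1 s @ C2 r) (B s) \<in> Lsym ?m L (Some b)"
  proof -
    have "foldl \<delta> q0 (conv (C1 s @ C2 r) (B s)) = foldl \<delta> q0 (conv (C1 r @ C2 r) (B r))"
      using rs(2) by (simp add: conv_split q_def)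
    also have "\<dots> \<in> F" using in_Lsym[of r] acc C12 by auto
    finally show ?thesis
      unfolding acc using conv_in_lists_pad_alph[OF _ listsB] listsC by simp
  qed
  then have "wprod ?m ((C1 s @ C2 r) @ [b]) = wprod ?m (B s)"
    unfolding Lsym_def by (auto simp: conv_inject)
  moreover have "(C1 s @ C2 r) @ [b] \<in> lists A" "B s \<in> lists A" "B s \<noteq> []"
    using listsC B(1)[of s] LA bA by auto
  ultimately have "cls k l (sp ((C1 s @ C2 r) @ [b])) = cls k l (sp (B s))"
    by (metis wprod_sp append_is_Nil_conv not_Cons_self2)
  \<comment> \<open>The left side contains \<open>r + l\<close> letters b, with the last one from
    the generator \<open>b\<close>; the right side contains \<open>s + l\<close>.\<close>
  then have "count_list (sp ((C1 s @ C2 r) @ [b])) False = count_list (sp (B s)) False"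
    by (simp add: cls_eq_iff pcong_count_b)
  moreover have "count_list (sp (B s)) False = s + l"
    using pcong_count_b[OF B(2)[of s]] by simp
  moreover have "count_list (sp [b]) False = 1"
  proof -
    have "pcong (rel_ab k l) (rep b) [False]" using rep[OF bA] by (simp add: b_def cls_eq_iff)
    from pcong_count_b[OF this] show ?thesis by (simp add: sp_def)
  qed
  ultimately show False using count1[of s] count2[of r] rs(1) by (simp add: sp_append)
qed

section \<open>The case of exponent at most one\<close>

text \<open>
  A word \<open>a\<^sup>n\<^sup>1 b \<dots> a\<^sup>n\<^sup>r b a\<^sup>j\<close> is encoded by the list of exponents \<open>n\<^sub>1, \<dots>, n\<^sub>r\<close> and by \<open>j\<close>.
\<close>
fun block_step :: "nat list \<times> nat \<Rightarrow> bool \<Rightarrow> nat list \<times> nat" where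
  "block_step (p, j) True = (p, Suc j)"
| "block_step (p, j) False = (p @ [j], 0)"

definition blocks :: "bool list \<Rightarrow> nat list \<times> nat" where
  "blocks w = foldl block_step ([], 0) w"

definition unblocks :: "nat list \<Rightarrow> nat \<Rightarrow> bool list" where
  "unblocks p j = concat (map (\<lambda>i. replicate i True @ [False]) p) @ replicate j True"

lemma blocks_Nil [simp]: "blocks [] = ([], 0)"
  by (simp add: blocks_def)

lemma blocks_snoc:
  "blocks w = (p, j) \<Longrightarrow> blocks (w @ [True]) = (p, Suc j)"
  "blocks w = (p, j) \<Longrightarrow> blocks (w @ [False]) = (p @ [j], 0)"
  by (simp_all add: blocks_def)

lemma blocks_append_as:
  assumes "blocks w = (p, j)"
  shows "blocks (w @ replicate n True) = (p, j + n)"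
proof (induction n)
  case (Suc n)
  then have "blocks ((w @ replicate n True) @ [True]) = (p, Suc (j + n))" by (rule blocks_snoc)
  then show ?case by (simp add: replicate_append_same)
qed (simp add: assms)

lemma blocks_append_b_as:
  assumes "blocks w = (p, j)"
  shows "blocks (w @ False # replicate n True) = (p @ [j], n)"
  using blocks_append_as[OF blocks_snoc(2)[OF assms], of n] by simp

lemma unblocks_snoc:
  "unblocks p j @ [True] = unblocks p (Suc j)"
  "unblocks p j @ [False] = unblocks (p @ [j]) 0"
  by (simp_all add: unblocks_def replicate_append_same)

lemma unblocks_append_as: "unblocks p j @ replicate n True = unblocks p (j + n)"
  by (simp add: unblocks_def replicate_add)

lemma unblocks_blocks: "blocks w = (p, j) \<Longrightarrow> unblocks p j = w"
proof (induction w arbitrary: p j rule: rev_induct)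
  case Nil
  then show ?case by (simp add: unblocks_def)
next
  case (snoc x w)
  obtain p' j' where pj: "blocks w = (p', j')" by fastforce
  then have "unblocks p' j' = w" by (rule snoc.IH)
  with snoc.prems pj show ?case
    by (cases x) (auto simp: blocks_snoc simp flip: unblocks_snoc)
qed

lemma blocks_unblocks: "blocks (unblocks p j) = (p, j)"
proof -
  have "blocks (unblocks p 0) = (p, 0)" for p
  proof (induction p rule: rev_induct)
    case (snoc i p)
    have "unblocks (p @ [i]) 0 = (unblocks p 0 @ replicate i True) @ [False]"
      by (simp add: unblocks_def)
    then show ?case using blocks_snoc(2)[OF blocks_append_as[OF snoc]] by simp
  qed (simp add: unblocks_def)
  from blocks_append_as[OF this] show ?thesis by (simp add: unblocks_append_as)
qed

section \<open>Normal forms\<close>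

text \<open>For \<open>l = 0\<close> the relation makes \<open>a^k\<close> trivial everywhere, also
  at the end of a word; for \<open>l = 1\<close> the trailing a's have no b that could absorb
  them.\<close>

definition tail_nf :: "nat \<Rightarrow> nat \<Rightarrow> nat \<Rightarrow> nat" where
  "tail_nf k l j = (if l = 0 then j mod k else j)"

lemma tail_nf_add_cong:
  "tail_nf k l i = tail_nf k l j \<Longrightarrow> tail_nf k l (n + i) = tail_nf k l (n + j)"
  "tail_nf k l i = tail_nf k l j \<Longrightarrow> tail_nf k l (i + n) = tail_nf k l (j + n)"
  by (auto simp: tail_nf_def intro: mod_add_cong)

lemma tail_nf_mod_cong: "tail_nf k l i = tail_nf k l j \<Longrightarrow> i mod k = j mod k"
  by (auto simp: tail_nf_def split: if_splits)

text \<open>For \<open>l <= 1\<close> this is a complete invariant of the congruence, as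
  \<open>cls_eq_iff_nf\<close> shows.\<close>

definition nf :: "nat \<Rightarrow> nat \<Rightarrow> bool list \<Rightarrow> nat list \<times> nat" where
  "nf k l w = (case blocks w of (p, j) \<Rightarrow> (map (\<lambda>i. i mod k) p, tail_nf k l j))"

text \<open>Reduces invariance under a rewriting step to a step at the right end of a word. An
  appended b turns the tail into a block, and equal tails give equal residues modulo
  \<open>k\<close>.\<close>

lemma nf_append_cong: "nf k l u = nf k l v \<Longrightarrow> nf k l (u @ y) = nf k l (v @ y)"
proof (induction y rule: rev_induct)
  case (snoc x y)
  obtain p i q j where b: "blocks (u @ y) = (p, i)" "blocks (v @ y) = (q, j)" by fastforce
  have eq: "map (\<lambda>i. i mod k) p = map (\<lambda>i. i mod k) q" "tail_nf k l i = tail_nf k l j"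
    using snoc by (simp_all add: nf_def b)
  have "nf k l ((u @ y) @ [x]) = nf k l ((v @ y) @ [x])"
  proof (cases x)
    case True
    then show ?thesis using eq tail_nf_add_cong(1)[OF eq(2), of 1]
      by (simp add: nf_def blocks_snoc(1)[OF b(1)] blocks_snoc(1)[OF b(2)] del: append_assoc)
  next
    case False
    then show ?thesis using eq tail_nf_mod_cong[OF eq(2)]
      by (simp add: nf_def blocks_snoc(2)[OF b(1)] blocks_snoc(2)[OF b(2)] del: append_assoc)
  qed
  then show ?case by simp
qed simp

lemma nf_cong:
  assumes "l \<le> 1" "pcong (rel_ab k l) u v"
  shows "nf k l u = nf k l v"
  using assms(2)
proof (induction rule: pcong.induct)
  case (step u v x y)
  obtain p j where b: "blocks x = (p, j)" by fastforce
  have "nf k l (x @ u) = nf k l (x @ v)"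
  proof (cases "l = 0")
    case True
    with step show ?thesis
      by (simp add: rel_ab_def nf_def b blocks_append_as[OF b] tail_nf_def)
  next
    case False
    then have "l = 1" using assms(1) by simp
    with step show ?thesis
      using blocks_snoc(2)[OF b] blocks_snoc(2)[OF blocks_append_as[OF b, of k]]
      by (simp add: rel_ab_def nf_def b)
  qed
  then show ?case using nf_append_cong[of k l "x @ u" "x @ v" y] by simp
qed auto

lemma pcong_mod_b:
  assumes "l \<le> 1"
  shows "pcong (rel_ab k l) (x @ replicate j True @ [False]) (x @ replicate (j mod k) True @ [False])"
proof -
  have "replicate j True = replicate (j mod k) True @ replicate (k * (j div k)) True"
    by (simp flip: replicate_add)
  \<comment> \<open>The padding \<open>b^(1 - l)\<close> supplies the letter b when
    \<open>l = 0\<close>, so both values of \<open>l\<close> are treated at once.\<close>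
  moreover have "pcong (rel_ab k l)
      ((x @ replicate (j mod k) True) @ replicate (k * (j div k)) True @ replicate l False @
        replicate (1 - l) False)
      ((x @ replicate (j mod k) True) @ replicate l False @ replicate (1 - l) False)"
    by (rule pcong_absorb_power)
  moreover have "replicate l False @ replicate (1 - l) False = [False]"
    using assms by (cases l) auto
  ultimately show ?thesis by (simp only: append_assoc)
qed

lemma pcong_tail_nf:
  "pcong (rel_ab k l) (x @ replicate j True) (x @ replicate (tail_nf k l j) True)"
proof (cases "l = 0")
  case True
  have "replicate j True = replicate (j mod k) True @ replicate (k * (j div k)) True"
    by (simp flip: replicate_add)
  moreover have "pcong (rel_ab k 0)
      ((x @ replicate (j mod k) True) @ replicate (k * (j div k)) True @ replicate 0 False @ [])
      ((x @ replicate (j mod k) True) @ replicate 0 False @ [])"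
    by (rule pcong_absorb_power)
  ultimately show ?thesis using True by (simp add: tail_nf_def)
qed (simp add: tail_nf_def pcong.refl)

text \<open>Completeness of the invariant: words with the same normal form are congruent to one and
  the same word.\<close>

lemma pcong_unblocks_nf:
  assumes "l \<le> 1"
  shows "pcong (rel_ab k l) w (case nf k l w of (p, j) \<Rightarrow> unblocks p j)"
proof -
  have "pcong (rel_ab k l) (unblocks p 0) (unblocks (map (\<lambda>i. i mod k) p) 0)" for p
  proof (induction p rule: rev_induct)
    case (snoc i p)
    let ?q = "map (\<lambda>i. i mod k) p"
    have "pcong (rel_ab k l) (unblocks p 0 @ replicate i True @ [False])
        (unblocks ?q 0 @ replicate i True @ [False])"
      using pcong_append[OF snoc, of "[]"] by simp
    then have "pcong (rel_ab k l) (unblocks p 0 @ replicate i True @ [False])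
        (unblocks ?q 0 @ replicate (i mod k) True @ [False])"
      using pcong_mod_b[OF assms] pcong.trans by blast
    then show ?case by (simp add: unblocks_def)
  qed (simp add: pcong.refl)
  from pcong_append[OF this, of "[]"]
  have "pcong (rel_ab k l) (unblocks p j) (unblocks (map (\<lambda>i. i mod k) p) 0 @ replicate j True)" for p j
    by (metis append_Nil unblocks_append_as add_0)
  from pcong.trans[OF this pcong_tail_nf]
  have "pcong (rel_ab k l) (unblocks p j) (unblocks (map (\<lambda>i. i mod k) p) (tail_nf k l j))" for p j
    by (simp add: unblocks_append_as)
  then show ?thesis
    by (cases "blocks w") (auto simp: nf_def dest: unblocks_blocks)
qed

lemma cls_eq_iff_nf:
  assumes "l \<le> 1"
  shows "cls k l u = cls k l v \<longleftrightarrow> nf k l u = nf k l v"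
proof
  assume "cls k l u = cls k l v"
  then show "nf k l u = nf k l v" using assms by (simp add: cls_eq_iff nf_cong)
next
  assume "nf k l u = nf k l v"
  then show "cls k l u = cls k l v"
    using pcong_unblocks_nf[OF assms, of k u] pcong_unblocks_nf[OF assms, of k v]
    unfolding cls_eq_iff by (metis pcong.sym pcong.trans)
qed

text \<open>
  The nonempty words without factor \<open>a\<^sup>kb\<close>. For \<open>l = 0\<close> they are not unique representatives,
  but they contain the nonempty representative \<open>a\<^sup>k\<close> of the identity.
\<close>
definition reps :: "nat \<Rightarrow> bool list set" where
  "reps k = {w. w \<noteq> [] \<and> (\<forall>i\<in>set (fst (blocks w)). i < k)}"

lemma reps_prefix_closed: "u @ v \<in> reps k \<Longrightarrow> u \<noteq> [] \<Longrightarrow> u \<in> reps k"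
proof (induction v rule: rev_induct)
  case (snoc x v)
  obtain p j where "blocks (u @ v) = (p, j)" by fastforce
  with snoc.prems have "u @ v \<in> reps k"
    using blocks_snoc[of "u @ v" p j] by (cases x) (auto simp: reps_def)
  with snoc show ?case by blast
qed simp

lemma finite_quots_reps: "finite_quots (reps k)"
proof -
  \<comment> \<open>\<open>None\<close> is a sink; \<open>Some c\<close> records the number of a's
    since the last b, capped at \<open>k\<close>, and at \<open>k\<close> a further b is
    forbidden.\<close>
  define \<delta> where "\<delta> c x = (case c of None \<Rightarrow> None
    | Some c \<Rightarrow> if x then Some (min k (Suc c)) else if c < k then Some 0 else None)"
    for c :: "nat option" and x :: bool
  have run: "foldl \<delta> (Some 0) w = (case blocks w of (p, j) \<Rightarrow>
      if \<forall>i\<in>set p. i < k then Some (min k j) else None)" for w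
  proof (induction w rule: rev_induct)
    case (snoc x w)
    obtain p j where b: "blocks w = (p, j)" by fastforce
    with snoc show ?case
      by (cases x) (auto simp: \<delta>_def blocks_snoc[OF b])
  qed simp
  have "range (foldl \<delta> (Some 0)) \<subseteq> insert None (Some ` {..k})"
    by (auto simp: run split: prod.splits)
  then have "finite (range (foldl \<delta> (Some 0)))" by (rule finite_subset) simp
  then have "finite_quots {w. foldl \<delta> (Some 0) w \<in> - {None}}" by (rule finite_quots_dfa)
  moreover have "finite_quots (- {[] :: bool list})"
    by (rule finite_quots_classify[of "\<lambda>w. w = []"])
      (auto simp: quot_def intro: finite_subset[OF subset_UNIV])
  ultimately have "finite_quots ({w. foldl \<delta> (Some 0) w \<in> - {None}} \<inter> - {[]})"
    by (rule finite_quots_Int)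
  moreover have "reps k = {w. foldl \<delta> (Some 0) w \<in> - {None}} \<inter> - {[]}"
    by (auto simp: reps_def run case_prod_beta split: if_splits)
  ultimately show ?thesis by simp
qed

section \<open>Regularity of equality and of right multiplication\<close>

text \<open>Over one letter only lengths matter, so quotients correspond to shifts of
  \<open>P\<close>.\<close>

lemma finite_quots_unary:
  assumes "finite (range (\<lambda>n. {m. P (n + m)}))"
  shows "finite_quots {replicate n x | n. P n}"
proof (rule finite_quots_classify)
  let ?f = "\<lambda>w. (set w \<subseteq> {x}, {m. P (length w + m)})"
  have "range ?f \<subseteq> UNIV \<times> range (\<lambda>n. {m. P (n + m)})" by auto
  then show "finite (range ?f)" by (rule finite_subset) (use assms in simp)
  have "replicate (length w) x = w" if "set w \<subseteq> {x}" for w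
    using that by (intro replicate_length_same) auto
  then have mem: "w \<in> {replicate n x | n. P n} \<longleftrightarrow> set w \<subseteq> {x} \<and> P (length w)" for w
    by auto metis
  show "quot w {replicate n x | n. P n} = quot w' {replicate n x | n. P n}" if "?f w = ?f w'" for w w'
    unfolding quot_def mem using that by auto
qed

lemma finite_quots_tail_nf:
  assumes "k \<ge> 1"
  shows "finite_quots {replicate n True | n. tail_nf k l n = tail_nf k l r}"
proof (rule finite_quots_unary)
  show "finite (range (\<lambda>n. {m. tail_nf k l (n + m) = tail_nf k l r}))"
  proof (cases "l = 0")
    case True
    have "{m. tail_nf k l (n + m) = tail_nf k l r} = {m. (n mod k + m) mod k = r mod k}" for n
      using True by (simp add: tail_nf_def mod_add_left_eq)
    then have "range (\<lambda>n. {m. tail_nf k l (n + m) = tail_nf k l r})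
        \<subseteq> (\<lambda>n. {m. (n + m) mod k = r mod k}) ` {..<k}"
      using assms by auto
    then show ?thesis by (rule finite_subset) simp
  next
    case False
    have "range (\<lambda>n. {m. n + m = r}) \<subseteq> Pow {..r}" by auto
    then have "finite (range (\<lambda>n. {m. n + m = r}))" by (rule finite_subset) simp
    then show ?thesis using False by (simp add: tail_nf_def)
  qed
qed

text \<open>Blocks of words in \<open>reps k\<close> are already reduced, so the two words can
  differ only in their trailing a's. The residue \<open>r\<close> links \<open>s\<close> with
  \<open>t\<close>; as it has finitely many values, the relation is a finite union of
  products.\<close>

lemma nf_append_a_eq_iff:
  assumes "k \<ge> 1" "u \<in> reps k" "v \<in> reps k"
  shows "nf k l (u @ replicate c True) = nf k l v \<longleftrightarrow>
    (\<exists>r<k. \<exists>w s t. u = w @ replicate s True \<and> v = w @ replicate t True \<and>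
      tail_nf k l s = tail_nf k l r \<and> tail_nf k l t = tail_nf k l (r + c))" (is "?L \<longleftrightarrow> ?R")
proof
  obtain p j q i where b: "blocks u = (p, j)" "blocks v = (q, i)" by fastforce
  have small: "map (\<lambda>i. i mod k) p = p" "map (\<lambda>i. i mod k) q = q"
    using assms(2,3) by (auto simp: reps_def b intro: map_idI)
  assume ?L
  then have eq: "p = q" "tail_nf k l (j + c) = tail_nf k l i"
    using small by (simp_all add: nf_def b blocks_append_as[OF b(1)])
  have uv: "u = unblocks p j" "v = unblocks p i" using b eq(1) unblocks_blocks by auto
  show ?R
  proof (cases "l = 0")
    case True
    \<comment> \<open>Here \<open>w\<close> ends at the last b, and \<open>r\<close> is the residue
      of the trailing exponent of \<open>u\<close>.\<close>
    have "u = unblocks p 0 @ replicate j True" "v = unblocks p 0 @ replicate i True"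
      by (simp_all add: uv unblocks_append_as)
    moreover have "tail_nf k l j = tail_nf k l (j mod k)"
      "tail_nf k l i = tail_nf k l (j mod k + c)" "j mod k < k"
      using True eq(2) assms(1) by (simp_all add: tail_nf_def mod_add_left_eq)
    ultimately show ?thesis by blast
  next
    case False
    \<comment> \<open>For \<open>l > 0\<close> tails are not reduced: the witnesses are
      \<open>w = u\<close>, \<open>r = 0\<close>, \<open>s = 0\<close> and
      \<open>t = c\<close>.\<close>
    then have "v = u @ replicate c True" using eq(2) by (simp add: tail_nf_def uv unblocks_append_as)
    moreover have "u = u @ replicate 0 True" by simp
    ultimately show ?thesis using assms(1) by (metis add_0 less_eq_Suc_le One_nat_def)
  qed
next
  assume ?R
  then obtain r w s t where *: "u = w @ replicate s True" "v = w @ replicate t True"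
      "tail_nf k l s = tail_nf k l r" "tail_nf k l t = tail_nf k l (r + c)" by blast
  obtain p j where b: "blocks w = (p, j)" by fastforce
  have "tail_nf k l (s + c) = tail_nf k l t" using * tail_nf_add_cong(2) by metis
  then have "tail_nf k l (j + (s + c)) = tail_nf k l (j + t)" by (rule tail_nf_add_cong(1))
  then show ?L
    using blocks_append_as[OF b, of "s + c"] blocks_append_as[OF b, of t]
    by (simp add: nf_def *(1,2) flip: replicate_add)
qed

text \<open>The appended b closes the last block of \<open>u\<close>, whose exponent
  \<open>j\<close> appears in \<open>v\<close> as \<open>j mod k\<close>. The surplus
  \<open>s = j - j mod k\<close> is a multiple of \<open>k\<close> for either value of
  \<open>l\<close>, which is what \<open>tail_nf k 0\<close> expresses.\<close>

lemma nf_append_b_eq_iff: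
  assumes "u \<in> reps k" "v \<in> reps k"
  shows "nf k l (u @ [False]) = nf k l v \<longleftrightarrow>
    (\<exists>w s t. u = w @ replicate s True \<and> v = w @ False # replicate t True \<and>
      tail_nf k 0 s = tail_nf k 0 0 \<and> tail_nf k l t = tail_nf k l 0)" (is "?L \<longleftrightarrow> ?R")
proof
  obtain p j q i where b: "blocks u = (p, j)" "blocks v = (q, i)" by fastforce
  have small: "map (\<lambda>i. i mod k) p = p" "map (\<lambda>i. i mod k) q = q"
    using assms by (auto simp: reps_def b intro: map_idI)
  assume ?L
  then have eq: "q = p @ [j mod k]" "tail_nf k l 0 = tail_nf k l i"
    using small by (simp_all add: nf_def b blocks_snoc[OF b(1)])
  have "u = unblocks p (j mod k) @ replicate (j - j mod k) True"
    using unblocks_blocks[OF b(1)] by (simp add: unblocks_append_as)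
  moreover have "v = unblocks p (j mod k) @ False # replicate i True"
    using unblocks_blocks[OF b(2)] by (simp add: eq(1) unblocks_def)
  moreover have "tail_nf k 0 (j - j mod k) = tail_nf k 0 0"
    by (simp add: tail_nf_def minus_mod_eq_mult_div)
  ultimately show ?R using eq(2) by metis
next
  assume ?R
  then obtain w s t where *: "u = w @ replicate s True" "v = w @ False # replicate t True"
      "s mod k = 0" "tail_nf k l t = tail_nf k l 0" by (auto simp: tail_nf_def)
  obtain p j where b: "blocks w = (p, j)" by fastforce
  have "(j + s) mod k = j mod k" using *(3) by (metis add_0_right mod_add_right_eq)
  then show ?L
    using blocks_snoc(2)[OF blocks_append_as[OF b, of s]] blocks_append_b_as[OF b, of t] *(4)
    by (simp add: nf_def *(1,2))
qed

text \<open>The case \<open>c = 0\<close> is equality, and \<open>c = 1\<close> is right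
  multiplication by a. Intersecting with pairs from \<open>reps k\<close> restores the membership
  that the common-prefix form leaves open.\<close>

lemma finite_quots_append_a_graph:
  assumes "k \<ge> 1"
  shows "finite_quots {conv u v | u v. u \<in> reps k \<and> v \<in> reps k \<and>
    nf k l (u @ replicate c True) = nf k l v}"
proof -
  let ?T = "\<lambda>r. {replicate n True | n. tail_nf k l n = tail_nf k l r}"
  let ?P = "\<lambda>r x y. x \<in> ?T r \<and> y \<in> ?T (r + c)"
  have "finite_quots ({conv u v | u v. u \<in> reps k \<and> v \<in> reps k} \<inter>
      (\<Union>r<k. {conv (w @ x) (w @ y) | w x y. ?P r x y}))"
    using assms
    by (intro finite_quots_Int finite_quots_UN finite_quots_conv_common_prefix
        finite_quots_conv_product finite_quots_reps finite_quots_tail_nf) auto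
  moreover have "{conv u v | u v. u \<in> reps k \<and> v \<in> reps k \<and>
      nf k l (u @ replicate c True) = nf k l v} =
    {conv u v | u v. u \<in> reps k \<and> v \<in> reps k} \<inter>
      (\<Union>r<k. {conv (w @ x) (w @ y) | w x y. ?P r x y})" (is "?A = ?B")
  proof (intro equalityI subsetI)
    fix \<gamma> assume "\<gamma> \<in> ?A"
    then obtain u v where uv: "\<gamma> = conv u v" "u \<in> reps k" "v \<in> reps k"
      "nf k l (u @ replicate c True) = nf k l v" by blast
    then obtain r w s t where "r < k" "u = w @ replicate s True" "v = w @ replicate t True"
      "tail_nf k l s = tail_nf k l r" "tail_nf k l t = tail_nf k l (r + c)"
      using nf_append_a_eq_iff[OF assms uv(2,3), of l c] by metis
    then have "\<gamma> \<in> {conv (w @ x) (w @ y) | w x y. ?P r x y}" using uv(1) by blast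
    then show "\<gamma> \<in> ?B" using uv \<open>r < k\<close> by blast
  next
    fix \<gamma> assume "\<gamma> \<in> ?B"
    then obtain r w s t where \<gamma>: "\<gamma> = conv (w @ replicate s True) (w @ replicate t True)"
      "w @ replicate s True \<in> reps k" "w @ replicate t True \<in> reps k" "r < k"
      "tail_nf k l s = tail_nf k l r" "tail_nf k l t = tail_nf k l (r + c)"
      by (auto simp: conv_inject)
    then have "nf k l ((w @ replicate s True) @ replicate c True) = nf k l (w @ replicate t True)"
      using nf_append_a_eq_iff[OF assms \<gamma>(2,3), of l c] by metis
    then show "\<gamma> \<in> ?A" using \<gamma>(1-3) by blast
  qed
  ultimately show ?thesis by simp
qed

lemma finite_quots_append_b_graph:
  assumes "k \<ge> 1"
  shows "finite_quots {conv u v | u v. u \<in> reps k \<and> v \<in> reps k \<and>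
    nf k l (u @ [False]) = nf k l v}"
proof -
  let ?T = "\<lambda>l. {replicate n True | n. tail_nf k l n = tail_nf k l 0}"
  let ?P = "\<lambda>x y. x \<in> ?T 0 \<and> y \<in> (#) False ` ?T l"
  have "finite_quots ({conv u v | u v. u \<in> reps k \<and> v \<in> reps k} \<inter>
      {conv (w @ x) (w @ y) | w x y. ?P x y})"
    using assms
    by (intro finite_quots_Int finite_quots_conv_common_prefix finite_quots_Cons_image
        finite_quots_conv_product finite_quots_reps finite_quots_tail_nf) auto
  moreover have "{conv u v | u v. u \<in> reps k \<and> v \<in> reps k \<and> nf k l (u @ [False]) = nf k l v} =
    {conv u v | u v. u \<in> reps k \<and> v \<in> reps k} \<inter>
      {conv (w @ x) (w @ y) | w x y. ?P x y}" (is "?A = ?B")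
  proof (intro equalityI subsetI)
    fix \<gamma> assume "\<gamma> \<in> ?A"
    then obtain u v where "\<gamma> = conv u v" "u \<in> reps k" "v \<in> reps k"
      "nf k l (u @ [False]) = nf k l v" by blast
    with nf_append_b_eq_iff[OF this(2,3)] show "\<gamma> \<in> ?B" by blast
  next
    fix \<gamma> assume "\<gamma> \<in> ?B"
    then obtain w s t where \<gamma>: "\<gamma> = conv (w @ replicate s True) (w @ False # replicate t True)"
      "w @ replicate s True \<in> reps k" "w @ False # replicate t True \<in> reps k"
      "tail_nf k 0 s = tail_nf k 0 0" "tail_nf k l t = tail_nf k l 0"
      by (auto simp: conv_inject)
    with nf_append_b_eq_iff[OF \<gamma>(2,3)] show "\<gamma> \<in> ?A" by blast
  qed
  ultimately show ?thesis by simp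
qed

section \<open>The prefix-automatic structure\<close>

text \<open>The word of the normal form is a representative unless it is empty. This happens only
  for \<open>l = 0\<close> and words equal to the identity, which \<open>a^k\<close>
  represents.\<close>

lemma reps_complete:
  assumes "k \<ge> 1" "l \<le> 1" "w \<noteq> []"
  shows "\<exists>u\<in>reps k. cls k l u = cls k l w"
proof -
  obtain p j where pj: "nf k l w = (p, j)" by fastforce
  have w: "cls k l (unblocks p j) = cls k l w"
    using pcong_unblocks_nf[OF assms(2), of k w] pj by (simp add: cls_eq_iff pcong.sym)
  have small: "\<forall>i\<in>set p. i < k" using pj assms(1) by (auto simp: nf_def split: prod.splits)
  show ?thesis
  proof (cases "unblocks p j = []")
    case False
    then show ?thesis using w small by (auto simp: reps_def blocks_unblocks)
  next
    case True
    then have "pcong (rel_ab k l) w []" using w by (simp add: cls_eq_iff pcong.sym)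
    have "l = 0"
    proof (rule ccontr)
      assume "l \<noteq> 0"
      have "nf k l w = nf k l []" using \<open>pcong (rel_ab k l) w []\<close> nf_cong assms(2) by blast
      then have "blocks w = ([], 0)" using \<open>l \<noteq> 0\<close>
        by (auto simp: nf_def tail_nf_def split: prod.splits)
      then show False using unblocks_blocks[of w] assms(3) by (simp add: unblocks_def)
    qed
    then have "pcong (rel_ab k l) (replicate k True) []"
      using pcong_absorb_power[of k 0 "[]" 1 "[]"] by simp
    moreover have "replicate k True \<in> reps k"
      using assms(1) blocks_append_as[OF blocks_Nil, of k] by (auto simp: reps_def)
    ultimately show ?thesis
      using \<open>pcong (rel_ab k l) w []\<close> by (metis cls_eq_iff)
  qed
qed

lemma prefix_automatic_le_1:
  assumes "k \<ge> 1" "l \<le> 1"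
  shows "prefix_automatic (S_ab k l) (mult_ab k l)"
proof -
  define h where "h c = cls k l [c]" for c
  define A where "A = range h"
  define L where "L = map h ` reps k"
  let ?m = "mult_ab k l"
  \<comment> \<open>The normal forms of a and b differ in their number of blocks, even when
    \<open>k = 1\<close>. Injectivity of \<open>h\<close> then carries languages over
    \<open>bool\<close> to words over \<open>A\<close>.\<close>
  have "h True \<noteq> h False"
    using assms(2) by (simp add: h_def cls_eq_iff_nf nf_def blocks_def)
  then have inj: "inj h" by (auto simp: inj_def) (metis (full_types))+
  then have inj2: "inj (map_prod (map_option h) (map_option h))"
    by (simp add: prod.inj_map option.inj_map)
  have finA: "finite A" by (simp add: A_def)
  have LA: "L \<subseteq> lists A - {[]}" by (auto simp: L_def A_def reps_def)
  have wprod_h: "wprod ?m (map h w) = cls k l w" if "w \<noteq> []" for w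
    using wprod_cls[of "map (\<lambda>c. [c]) w" k l] that by (simp add: h_def[abs_def] comp_def)
  have reps_ne: "u \<noteq> []" if "u \<in> reps k" for u using that by (simp add: reps_def)
  have finpad: "finite (pad_alph A)" using finA by (simp add: pad_alph_def)
  have regular_graph: "regular (pad_alph A) {conv (map h u) (map h v) | u v. P u v}"
    if "finite_quots {conv u v | u v. P u v}" for P
  proof (rule regular_if_finite_quots[OF finpad])
    show "{conv (map h u) (map h v) | u v. P u v} \<subseteq> lists (pad_alph A)"
      using conv_in_lists_pad_alph[of "map h _" A "map h _"] by (force simp: A_def)
    have "{conv (map h u) (map h v) | u v. P u v} =
      map (map_prod (map_option h) (map_option h)) ` {conv u v | u v. P u v}"
      by (auto simp: conv_map)
    then show "finite_quots {conv (map h u) (map h v) | u v. P u v}"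
      using finite_quots_map_image[OF that inj2] by simp
  qed
  have Lsym_eq: "{conv \<alpha> \<beta> | \<alpha> \<beta>. \<alpha> \<in> L \<and> \<beta> \<in> L \<and> wprod ?m (\<alpha> @ map h x) = wprod ?m \<beta>} =
      {conv (map h u) (map h v) | u v. u \<in> reps k \<and> v \<in> reps k \<and> nf k l (u @ x) = nf k l v}" for x
  proof -
    have "wprod ?m (map h u @ map h x) = wprod ?m (map h v) \<longleftrightarrow> nf k l (u @ x) = nf k l v"
      if "u \<in> reps k" "v \<in> reps k" for u v
      using that[THEN reps_ne] wprod_h[of "u @ x"] wprod_h[of v]
      by (simp add: cls_eq_iff_nf[OF assms(2)])
    then show ?thesis unfolding L_def by blast
  qed
  have Lnone: "regular (pad_alph A) (Lsym ?m L None)"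
    using Lsym_eq[of "[]"] regular_graph[OF finite_quots_append_a_graph[OF assms(1), of l 0]]
    by (simp add: Lsym_def)
  have La: "regular (pad_alph A) (Lsym ?m L (Some (h True)))"
    using Lsym_eq[of "[True]"] regular_graph[OF finite_quots_append_a_graph[OF assms(1), of l 1]]
    by (simp add: Lsym_def)
  have Lb: "regular (pad_alph A) (Lsym ?m L (Some (h False)))"
    using Lsym_eq[of "[False]"] regular_graph[OF finite_quots_append_b_graph[OF assms(1), of l]]
    by (simp add: Lsym_def)
  have "wprod ?m ` L = S_ab k l"
  proof
    show "wprod ?m ` L \<subseteq> S_ab k l" using reps_ne wprod_h by (auto simp: L_def S_ab_def)
    show "S_ab k l \<subseteq> wprod ?m ` L"
    proof
      fix X assume "X \<in> S_ab k l"
      then obtain w where "X = cls k l w" "w \<noteq> []" by (auto simp: S_ab_def)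
      then obtain u where "u \<in> reps k" "X = cls k l u" using reps_complete assms by metis
      then have "X = wprod ?m (map h u)" using wprod_h reps_ne by simp
      then show "X \<in> wprod ?m ` L" using \<open>u \<in> reps k\<close> by (simp add: L_def)
    qed
  qed
  moreover have "regular A L"
    using LA by (intro regular_if_finite_quots finA)
      (auto simp: L_def intro: finite_quots_map_image finite_quots_reps inj)
  moreover have "A \<subseteq> S_ab k l" by (auto simp: A_def h_def S_ab_def)
  moreover have "\<forall>a\<in>insert None (Some ` A). regular (pad_alph A) (Lsym ?m L a)"
  proof -
    have "A = {h True, h False}" by (simp add: A_def UNIV_bool insert_commute)
    then show ?thesis using Lnone La Lb by simp
  qed
  ultimately have structure_AL: "automatic_structure (S_ab k l) ?m A L"
    using finA LA by (simp add: automatic_structure_def)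
  have Pref_L: "\<beta> \<in> Pref L \<and> \<beta> \<noteq> [] \<longleftrightarrow> \<beta> \<in> L" for \<beta>
  proof
    assume "\<beta> \<in> Pref L \<and> \<beta> \<noteq> []"
    then obtain \<gamma> u where u: "\<beta> @ \<gamma> = map h u" "u \<in> reps k" "\<beta> \<noteq> []"
      by (auto simp: Pref_def L_def)
    then obtain u1 u2 where "u = u1 @ u2" "\<beta> = map h u1" by (metis map_eq_append_conv)
    then show "\<beta> \<in> L" using u reps_prefix_closed[of u1 u2 k] by (auto simp: L_def)
  next
    assume "\<beta> \<in> L"
    then have "\<beta> @ [] \<in> L" "\<beta> \<noteq> []" using LA by auto
    then show "\<beta> \<in> Pref L \<and> \<beta> \<noteq> []" unfolding Pref_def by blast
  qed
  have "{conv \<alpha> \<beta> | \<alpha> \<beta>. \<alpha> \<in> L \<and> \<beta> \<in> Pref L \<and> \<beta> \<noteq> [] \<and> wprod ?m \<alpha> = wprod ?m \<beta>} =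
      Lsym ?m L None"
  proof -
    have "\<beta> \<in> Pref L \<and> \<beta> \<noteq> [] \<and> Q \<longleftrightarrow> \<beta> \<in> L \<and> Q" for \<beta> Q using Pref_L by metis
    then show ?thesis by (simp add: Lsym_def)
  qed
  with Lnone have "regular (pad_alph A)
      {conv \<alpha> \<beta> | \<alpha> \<beta>. \<alpha> \<in> L \<and> \<beta> \<in> Pref L \<and> \<beta> \<noteq> [] \<and> wprod ?m \<alpha> = wprod ?m \<beta>}"
    by (simp only:)
  with structure_AL show ?thesis unfolding prefix_automatic_def by (intro exI conjI)
qed

theorem theorem3p1p7:
  fixes k l :: nat
  assumes "k \<ge> 1"
  shows "prefix_automatic (S_ab k l) (mult_ab k l) \<longleftrightarrow> l \<le> 1"
proof
  assume "prefix_automatic (S_ab k l) (mult_ab k l)"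
  then have "automatic (S_ab k l) (mult_ab k l)"
    by (auto simp: prefix_automatic_def automatic_def)
  then show "l \<le> 1" using not_automatic[OF assms, of l] by linarith
next
  assume "l \<le> 1"
  then show "prefix_automatic (S_ab k l) (mult_ab k l)"
    using assms by (rule prefix_automatic_le_1[rotated])
qed

end
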